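(* Let $S\neq\mathbb{N}$ be a numerical semigroup with multiplicity $e$. If $S$ has maximal embedding dimension $e$ and $S$ is GAS, then $S$ is either almost symmetric, or 2-AGL with $2K\setminus K=\{F(S)-e,F(S)\}$.
   Context: A numerical semigroup is a submonoid $S$ of $(\mathbb{N},+)$ (with $0\in\mathbb{N}$) such that $\mathbb{N}\setminus S$ is finite. $F(S)=\max(\mathbb{Z}\setminus S)$, $M=S\setminus\{0\}$, the multiplicity is $e=\min M$, and $K=\{x\in\mathbb{N}\mid F(S)-x\notin S\}$. $S$ has a unique minimal system of generators, whose elements are the minimal generators of $S$; $S$ has maximal embedding dimension if the number of its minimal generators equals $e$. For sets $X,Y\subseteq\mathbb{Z}$, $X-Y=\{z\in\mathbb{Z}\mid z+Y\subseteq X\}$; $2K=K+K$. $PF(S)=(S-M)\setminus S$. $S$ is almost symmetric if $S-M=K\cup\{F(S)\}$. $S$ is 2-AGL if $|\langle K\rangle\setminus K|=2$, where $\langle K\rangle$ is the numerical semigroup generated by $K$. $S$ is GAS if either $2K=K$ or $2K\setminus K=\{F(S)-x_1,\dots,F(S)-x_r,F(S)\}$ for some $r\ge 0$ and some minimal generators $x_1,\dots,x_r$ of $S$ such that $x_i-x_j\notin PF(S)$ for every $i,j$. *)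

theory Defs
  imports Main "HOL.Hull" "HOL-Library.Set_Algebras"
begin

text \<open>
  All sets live in \<open>int\<close>, so that the Frobenius number, differences \<open>F(S) - x\<close> and the
  sets \<open>X - Y\<close> need no coercions; the natural numbers are \<open>{0..}\<close>. The sum \<open>X + Y\<close> of two
  sets is that of \<open>Set_Algebras\<close>, while \<open>X - Y\<close> in Isabelle notation is always the
  set-theoretic difference.
\<close>

definition add_submonoid :: "int set \<Rightarrow> bool" where
  "add_submonoid T \<longleftrightarrow> 0 \<in> T \<and> (\<forall>x\<in>T. \<forall>y\<in>T. x + y \<in> T)"

abbreviation generated :: "int set \<Rightarrow> int set" where
  "generated X \<equiv> add_submonoid hull X"

definition numerical_semigroup :: "int set \<Rightarrow> bool" where
  "numerical_semigroup S \<longleftrightarrow> S \<subseteq> {0..} \<and> add_submonoid S \<and> finite ({0..} - S)"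

text \<open>\<open>Max\<close> and \<open>Min\<close> are only meaningful for finite sets, but the complement of \<open>S\<close> in the
  integers and \<open>S - {0}\<close> are infinite.\<close>

definition frobenius :: "int set \<Rightarrow> int" where
  "frobenius S = (GREATEST z. z \<notin> S)"

definition max_ideal :: "int set \<Rightarrow> int set" where
  "max_ideal S = S - {0}"

definition semigroup_multiplicity :: "int set \<Rightarrow> int" where
  "semigroup_multiplicity S = (LEAST x. x \<in> max_ideal S)"

definition canonical_ideal :: "int set \<Rightarrow> int set" where
  "canonical_ideal S = {x. 0 \<le> x \<and> frobenius S - x \<notin> S}"

definition minimal_generating_system :: "int set \<Rightarrow> int set \<Rightarrow> bool" where
  "minimal_generating_system S A \<longleftrightarrow> generated A = S \<and> (\<forall>B. B \<subset> A \<longrightarrow> generated B \<noteq> S)"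

text \<open>Well defined on numerical semigroups by \<open>ex1_minimal_generating_system\<close> below.\<close>

definition minimal_generators :: "int set \<Rightarrow> int set" where
  "minimal_generators S = (THE A. minimal_generating_system S A)"

definition max_embedding_dim :: "int set \<Rightarrow> bool" where
  "max_embedding_dim S \<longleftrightarrow> int (card (minimal_generators S)) = semigroup_multiplicity S"

definition set_colon :: "int set \<Rightarrow> int set \<Rightarrow> int set" where
  "set_colon X Y = {z. (+) z ` Y \<subseteq> X}"

definition pseudo_frobenius :: "int set \<Rightarrow> int set" where
  "pseudo_frobenius S = set_colon S (max_ideal S) - S"

definition almost_symmetric :: "int set \<Rightarrow> bool" where
  "almost_symmetric S \<longleftrightarrow> set_colon S (max_ideal S) = canonical_ideal S \<union> {frobenius S}"

definition two_AGL :: "int set \<Rightarrow> bool" where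
  "two_AGL S \<longleftrightarrow> card (generated (canonical_ideal S) - canonical_ideal S) = 2"

definition GAS :: "int set \<Rightarrow> bool" where
  "GAS S \<longleftrightarrow>
    (let K = canonical_ideal S; F = frobenius S in
      K + K = K \<or>
      (\<exists>(r::nat) (x::nat \<Rightarrow> int).
        (\<forall>i\<in>{1..r}. x i \<in> minimal_generators S) \<and>
        (\<forall>i\<in>{1..r}. \<forall>j\<in>{1..r}. x i - x j \<notin> pseudo_frobenius S) \<and>
        (K + K) - K = {F - x i | i. i \<in> {1..r}} \<union> {F}))"

lemma add_submonoid_generated: "add_submonoid (generated X)"
  by (rule hull_in) (auto simp: add_submonoid_def)

lemma ex1_minimal_generating_system:
  assumes "numerical_semigroup S"
  shows "\<exists>!A. minimal_generating_system S A"
proof -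
  define G where "G = {x \<in> S - {0}. \<not> (\<exists>a\<in>S - {0}. \<exists>b\<in>S - {0}. x = a + b)}"
  have nonneg: "0 \<le> x" if "x \<in> S" for x
    using assms that by (auto simp: numerical_semigroup_def)
  have sub: "add_submonoid S"
    using assms by (simp add: numerical_semigroup_def)
  have "x \<in> generated G" if "x \<in> S" for x
    using that
  proof (induction "nat x" arbitrary: x rule: less_induct)
    case less
    have m: "0 \<in> generated G" "\<And>a b. a \<in> generated G \<Longrightarrow> b \<in> generated G \<Longrightarrow> a + b \<in> generated G"
      using add_submonoid_generated[of G] by (simp_all add: add_submonoid_def [of "generated G"])
    consider "x = 0" | "x \<in> G" | a b where "a \<in> S - {0}" "b \<in> S - {0}" "x = a + b"
      using less.prems by (auto simp: G_def)
    then show ?case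
    proof cases
      case 3
      then have "a > 0" "b > 0"
        using nonneg[of a] nonneg[of b] by auto
      then have "a \<in> generated G" "b \<in> generated G"
        using less.hyps[of a] less.hyps[of b] 3 by auto
      then show ?thesis
        using m 3 by blast
    qed (use m hull_subset[of G add_submonoid] in auto)
  qed
  moreover have "generated G \<subseteq> S"
    by (rule hull_minimal) (auto simp: G_def sub)
  ultimately have gen: "generated G = S"
    by blast
  have least: "G \<subseteq> A" if A: "generated A = S" for A
  proof
    fix g assume g: "g \<in> G"
    show "g \<in> A"
    proof (rule ccontr)
      assume "g \<notin> A"
      moreover have "A \<subseteq> S"
        using A hull_subset[of A add_submonoid] by auto
      ultimately have "A \<subseteq> S - {g}"
        by auto
      moreover have "add_submonoid (S - {g})"
        unfolding add_submonoid_def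
      proof (intro conjI ballI)
        show "0 \<in> S - {g}"
          using g sub by (auto simp: G_def add_submonoid_def)
        fix x y assume xy: "x \<in> S - {g}" "y \<in> S - {g}"
        then have "x + y \<in> S"
          using sub by (auto simp: add_submonoid_def)
        moreover have "x + y \<noteq> g"
          using xy g unfolding G_def by (cases "x = 0"; cases "y = 0") auto
        ultimately show "x + y \<in> S - {g}"
          by auto
      qed
      ultimately have "generated A \<subseteq> S - {g}"
        by (rule hull_minimal)
      then show False
        using A g by (auto simp: G_def)
    qed
  qed
  show ?thesis
    unfolding minimal_generating_system_def
    by (rule ex1I[of _ G]) (use gen least in blast)+
qed

end

theory Submission
  imports Defs
begin

text \<open>
  Write \<open>F\<close>, \<open>K\<close>, \<open>M\<close> for the Frobenius number, the canonical ideal and the maximal ideal of \<open>S\<close>.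
  The elements of \<open>2K\<close> outside \<open>K\<close> are exactly the differences \<open>F - m \<in> 2K\<close> with \<open>m \<in> S\<close>, so the
  GAS condition describes a set \<open>X\<close> of minimal generators: apart from \<open>F\<close> itself, the differences
  in \<open>2K\<close> are the \<open>F - x\<close> with \<open>x \<in> X\<close>.

  If \<open>X\<close> is empty, or if \<open>2K = K\<close>, then \<open>K + M \<subseteq> S\<close>: a sum \<open>k + m \<notin> S\<close> would give \<open>F - k - m \<in> K\<close> and
  hence \<open>F - m \<in> 2K\<close>. The inclusion \<open>K + M \<subseteq> S\<close> is almost symmetry
  (\<open>almost_symmetric_if_no_positive_difference\<close>).

  Otherwise maximal embedding dimension enters. The minimal generators are pairwise incongruent
  modulo \<open>e\<close>, so when there are \<open>e\<close> of them they represent every class, and this makes \<open>x - e\<close> a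
  pseudo-Frobenius number for each minimal generator \<open>x \<noteq> e\<close>
  (\<open>minimal_generator_minus_multiplicity\<close>). Adding a pseudo-Frobenius number \<open>\<alpha>\<close> to an element of \<open>K\<close>
  stays in \<open>K\<close>, with the single exception \<open>F - \<alpha>\<close>. Shifting one summand of \<open>F - x \<in> 2K\<close> by \<open>x - e\<close> thus
  yields \<open>F - e \<in> 2K\<close> (\<open>minus_multiplicity_in_double\<close>), that is, \<open>e \<in> X\<close>. Any other \<open>x \<in> X\<close> would
  violate the condition \<open>x - e \<notin> PF(S)\<close>, so \<open>X = {e}\<close>. Finally \<open>K \<union> {F - e, F}\<close> is closed under adding
  elements of \<open>K\<close>, hence is the semigroup generated by \<open>K\<close>, and \<open>S\<close> is 2-AGL.
\<close>

section \<open>Minimal generators\<close>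

lemma minimal_generating_system_minimal_generators:
  assumes "numerical_semigroup S"
  shows "minimal_generating_system S (minimal_generators S)"
  unfolding minimal_generators_def
  by (rule theI') (rule ex1_minimal_generating_system[OF assms])

lemma add_submonoidI:
  "0 \<in> T \<Longrightarrow> (\<And>x y. x \<in> T \<Longrightarrow> y \<in> T \<Longrightarrow> x + y \<in> T) \<Longrightarrow> add_submonoid T"
  by (simp add: add_submonoid_def)

lemma generated_add: "x \<in> generated A \<Longrightarrow> y \<in> generated A \<Longrightarrow> x + y \<in> generated A"
  using add_submonoid_generated[of A] by (auto simp: add_submonoid_def)

lemma zero_in_generated: "0 \<in> generated A"
  using add_submonoid_generated[of A] by (auto simp: add_submonoid_def)

lemma minimal_generator_notin_generated_others:
  assumes "minimal_generating_system S A" and "x \<in> A"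
  shows "x \<notin> generated (A - {x})"
proof
  assume "x \<in> generated (A - {x})"
  then have "A \<subseteq> generated (A - {x})"
    using hull_subset[of "A - {x}" add_submonoid] by auto
  then have "generated A \<subseteq> generated (A - {x})"
    by (rule hull_minimal) (rule add_submonoid_generated)
  moreover have "generated (A - {x}) \<subseteq> generated A"
    by (rule hull_mono) auto
  ultimately show False
    using assms unfolding minimal_generating_system_def by blast
qed

text \<open>
  An element of \<open>S\<close> below a generator \<open>x\<close> is generated without \<open>x\<close>. If \<open>x\<close> were a sum of two smaller
  elements, it would therefore be redundant.
\<close>

lemma minimal_generator_irreducible:
  assumes S: "numerical_semigroup S" and x: "x \<in> minimal_generators S"
    and a: "a \<in> S" "a \<noteq> 0" and b: "b \<in> S" "b \<noteq> 0"
  shows "x \<noteq> a + b"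
proof
  assume xab: "x = a + b"
  define A where "A = minimal_generators S"
  have A: "minimal_generating_system S A" "x \<in> A"
    using minimal_generating_system_minimal_generators[OF S] x by (simp_all add: A_def)
  have nonneg: "0 \<le> y" if "y \<in> S" for y
    using S that by (auto simp: numerical_semigroup_def)
  have gen: "generated A = S"
    using A by (simp add: minimal_generating_system_def)
  let ?B = "generated (A - {x})"
  let ?T = "?B \<union> {y \<in> S. x \<le> y}"
  have BS: "?B \<subseteq> S"
    using gen hull_mono[of "A - {x}" A add_submonoid] by auto
  have S_add: "y + z \<in> S" if "y \<in> S" "z \<in> S" for y z
    using S that by (auto simp: numerical_semigroup_def add_submonoid_def)
  have "add_submonoid ?T"
  proof (rule add_submonoidI)
    show "0 \<in> ?T"
      using zero_in_generated by simp
    fix y z assume yz: "y \<in> ?T" "z \<in> ?T"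
    then have "y \<in> S" "z \<in> S"
      using BS by auto
    then have "y + z \<in> S" "0 \<le> y" "0 \<le> z"
      using S_add nonneg by auto
    then show "y + z \<in> ?T"
      using yz generated_add[of y "A - {x}" z] by auto
  qed
  moreover have "A \<subseteq> ?T"
    using gen hull_subset[of A add_submonoid] hull_subset[of "A - {x}" add_submonoid] by auto
  ultimately have "S \<subseteq> ?T"
    using gen hull_minimal[of A ?T add_submonoid] by auto
  moreover have "a < x" "b < x"
    using xab nonneg[OF a(1)] nonneg[OF b(1)] a b by auto
  ultimately have "a \<in> ?B" "b \<in> ?B"
    using a b by auto
  then have "x \<in> ?B"
    unfolding xab by (rule generated_add)
  then show False
    using minimal_generator_notin_generated_others[OF A] by simp
qed

lemma minimal_generator_in_max_ideal:
  assumes S: "numerical_semigroup S" and x: "x \<in> minimal_generators S"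
  shows "x \<in> max_ideal S"
proof -
  note A = minimal_generating_system_minimal_generators[OF S]
  have "x \<in> S"
    using A x hull_subset[of "minimal_generators S" add_submonoid]
    by (auto simp: minimal_generating_system_def)
  moreover have "x \<noteq> 0"
    using minimal_generator_notin_generated_others[OF A x] zero_in_generated by auto
  ultimately show ?thesis
    by (simp add: max_ideal_def)
qed

section \<open>Frobenius number, multiplicity and canonical ideal\<close>

locale proper_numerical_semigroup =
  fixes S :: "int set"
  assumes numerical: "numerical_semigroup S" and proper: "S \<noteq> {0..}"
begin

abbreviation "F \<equiv> frobenius S"
abbreviation "K \<equiv> canonical_ideal S"
abbreviation "M \<equiv> max_ideal S"
abbreviation "e \<equiv> semigroup_multiplicity S"

lemma nonneg: "x \<in> S \<Longrightarrow> 0 \<le> x"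
  and zero_mem: "0 \<in> S"
  and add_mem: "x \<in> S \<Longrightarrow> y \<in> S \<Longrightarrow> x + y \<in> S"
  using numerical by (auto simp: numerical_semigroup_def add_submonoid_def)

lemma frobenius_notin: "F \<notin> S"
  and frobenius_less: "F < z \<Longrightarrow> z \<in> S"
  and frobenius_pos: "0 < F"
proof -
  define m where "m = Max ({0..} - S)"
  have fin: "finite ({0..} - S)"
    using numerical by (simp add: numerical_semigroup_def)
  moreover have "{0..} - S \<noteq> {}"
    using proper numerical by (auto simp: numerical_semigroup_def)
  ultimately have m: "m \<in> {0..} - S"
    unfolding m_def by (rule Max_in)
  have le: "z \<le> m" if "z \<notin> S" for z
  proof (cases "0 \<le> z")
    case True
    then show ?thesis
      unfolding m_def using that fin by (intro Max_ge) auto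
  qed (use m in auto)
  have "F = m"
    unfolding frobenius_def using m le by (intro Greatest_equality) auto
  then show "F \<notin> S" "F < z \<Longrightarrow> z \<in> S" "0 < F"
    using m le zero_mem by (fastforce simp: order.order_iff_strict)+
qed

lemma multiplicity_in_max_ideal: "e \<in> M"
  and multiplicity_le: "m \<in> M \<Longrightarrow> e \<le> m"
proof -
  have pos: "0 < m" if "m \<in> M" for m
    using that nonneg by (force simp: max_ideal_def)
  define n where "n = (LEAST n. int n \<in> M)"
  have "int (nat (F + 1)) \<in> M"
    using frobenius_less[of "F + 1"] frobenius_pos by (simp add: max_ideal_def)
  then have n: "int n \<in> M"
    unfolding n_def by (rule LeastI)
  have le: "int n \<le> m" if "m \<in> M" for m
    using Least_le[of "\<lambda>n. int n \<in> M" "nat m"] pos[OF that] that by (simp add: n_def)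
  have "e = int n"
    unfolding semigroup_multiplicity_def using n le by (rule Least_equality)
  then show "e \<in> M" "m \<in> M \<Longrightarrow> e \<le> m"
    using n le by simp_all
qed

lemma multiplicity_mem: "e \<in> S"
  and multiplicity_pos: "0 < e"
  using multiplicity_in_max_ideal nonneg[of e] by (auto simp: max_ideal_def)

lemma add_multiple_multiplicity:
  assumes "x \<in> S" and "0 \<le> k"
  shows "x + k * e \<in> S"
  using assms(2)
proof (induction k rule: int_ge_induct)
  case (step k)
  then show ?case
    using add_mem[of "x + k * e" e] multiplicity_mem by (simp add: algebra_simps)
qed (use assms in simp)

lemma canonical_ideal_iff: "x \<in> K \<longleftrightarrow> 0 \<le> x \<and> F - x \<notin> S"
  by (simp add: canonical_ideal_def)

lemma frobenius_notin_canonical_ideal: "F \<notin> K"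
  using zero_mem by (simp add: canonical_ideal_iff)

lemma zero_in_canonical_ideal: "0 \<in> K"
  using frobenius_notin by (simp add: canonical_ideal_iff)

lemma frobenius_minus_gap:
  assumes "x \<notin> S"
  shows "F - x \<in> K"
proof -
  have "x \<le> F"
    using assms frobenius_less[of x] by linarith
  then show ?thesis
    using assms by (simp add: canonical_ideal_iff)
qed

lemma canonical_ideal_subset_double: "K \<subseteq> K + K"
proof
  fix x assume "x \<in> K"
  then show "x \<in> K + K"
    using set_plus_intro[of x K 0 K] zero_in_canonical_ideal by simp
qed

lemma double_canonical_ideal_nonneg: "x \<in> K + K \<Longrightarrow> 0 \<le> x"
  by (auto simp: canonical_ideal_iff elim!: set_plus_elim)

section \<open>Almost symmetry\<close>

lemma almost_symmetric_if_sum_subset: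
  assumes KM: "\<And>k m. k \<in> K \<Longrightarrow> m \<in> M \<Longrightarrow> k + m \<in> S"
  shows "almost_symmetric S"
  unfolding almost_symmetric_def
proof
  show "set_colon S M \<subseteq> K \<union> {F}"
  proof
    fix z assume z: "z \<in> set_colon S M"
    show "z \<in> K \<union> {F}"
    proof (rule ccontr)
      assume nz: "z \<notin> K \<union> {F}"
      then have "F - z \<in> M"
        using frobenius_less[of "F - z"] by (auto simp: canonical_ideal_iff max_ideal_def)
      then have "z + (F - z) \<in> S"
        using z unfolding set_colon_def by blast
      then show False
        using frobenius_notin by simp
    qed
  qed
  have "F + m \<in> S" if "m \<in> M" for m
    using multiplicity_le[OF that] multiplicity_pos by (intro frobenius_less) auto
  then show "K \<union> {F} \<subseteq> set_colon S M"
    using KM by (auto simp: set_colon_def)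
qed

text \<open>
  If \<open>k + m\<close> is a gap of \<open>S\<close>, then \<open>F - m\<close> is the sum of the two elements \<open>k\<close> and \<open>F - (k + m)\<close> of \<open>K\<close>.
  So \<open>K + M \<subseteq> S\<close> holds as soon as no such difference lies in \<open>2K\<close>.
\<close>

lemma almost_symmetric_if_no_positive_difference:
  assumes "(K + K) - K \<subseteq> {F}"
  shows "almost_symmetric S"
proof (rule almost_symmetric_if_sum_subset, rule ccontr)
  fix k m assume k: "k \<in> K" and m: "m \<in> M" and "k + m \<notin> S"
  then have "k + (F - (k + m)) \<in> K + K"
    using frobenius_minus_gap by (intro set_plus_intro)
  then have "F - m \<in> (K + K) - K"
    using m by (auto simp: canonical_ideal_iff max_ideal_def)
  then show False
    using assms m by (auto simp: max_ideal_def)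
qed

section \<open>Maximal embedding dimension\<close>

lemma minimal_generators_incongruent:
  "inj_on (\<lambda>x. x mod e) (minimal_generators S)"
proof (rule linorder_inj_onI)
  fix x y assume xy: "x < y" "x \<in> minimal_generators S" "y \<in> minimal_generators S"
  show "x mod e \<noteq> y mod e"
  proof
    assume "x mod e = y mod e"
    then obtain k where k: "y = x + k * e"
      by (metis add.commute add_diff_cancel_left' diff_add_cancel dvd_def mod_eq_dvd_iff mult.commute)
    then have "0 < k * e"
      using xy by simp
    then have "0 < k"
      using multiplicity_pos by (simp add: zero_less_mult_iff)
    have "0 + (k - 1) * e + e \<in> S"
      using \<open>0 < k\<close> zero_mem multiplicity_mem by (intro add_mem add_multiple_multiplicity) auto
    then have "k * e \<in> S"
      by (simp add: algebra_simps)
    moreover have "x \<in> S" "x \<noteq> 0" "k * e \<noteq> 0"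
      using minimal_generator_in_max_ideal[OF numerical xy(2)] \<open>0 < k * e\<close>
      by (auto simp: max_ideal_def)
    ultimately show False
      using minimal_generator_irreducible[OF numerical xy(3)] k by blast
  qed
qed auto

lemma minimal_generator_in_every_class:
  assumes "max_embedding_dim S"
  obtains g where "g \<in> minimal_generators S" and "g mod e = z mod e"
proof -
  let ?G = "minimal_generators S"
  have "(\<lambda>x. x mod e) ` ?G \<subseteq> {0..<e}"
    using multiplicity_pos by auto
  moreover have "card ((\<lambda>x. x mod e) ` ?G) = card {0..<e}"
    using assms card_image[OF minimal_generators_incongruent]
    by (simp add: max_embedding_dim_def flip: int_int_eq)
  ultimately have "(\<lambda>x. x mod e) ` ?G = {0..<e}"
    by (intro card_subset_eq) auto
  moreover have "z mod e \<in> {0..<e}"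
    using multiplicity_pos by simp
  ultimately show ?thesis
    using that by (metis (no_types, lifting) imageE)
qed

text \<open>
  A minimal generator \<open>g\<close> congruent to the reducible element \<open>x + m\<close> must lie strictly below it,
  since otherwise \<open>g\<close> would be reducible too. Hence \<open>x + m - e\<close> is \<open>g\<close> plus a nonnegative multiple of
  \<open>e\<close>.
\<close>

lemma minimal_generator_minus_multiplicity:
  assumes med: "max_embedding_dim S" and x: "x \<in> minimal_generators S" and xe: "x \<noteq> e"
  shows "x - e \<in> pseudo_frobenius S"
proof -
  have xM: "x \<in> M"
    using minimal_generator_in_max_ideal[OF numerical x] .
  have "x - e \<notin> S"
    using minimal_generator_irreducible[OF numerical x, of "x - e" e] multiplicity_mem
      multiplicity_pos xe by auto
  moreover have "x - e + m \<in> S" if m: "m \<in> M" for m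
  proof -
    obtain g where g: "g \<in> minimal_generators S" "g mod e = (x + m) mod e"
      using minimal_generator_in_every_class[OF med] .
    then obtain k where k: "x + m = g + k * e"
      by (metis add.commute add_diff_cancel_left' diff_add_cancel dvd_def mod_eq_dvd_iff mult.commute)
    have "0 < k"
    proof (rule ccontr)
      assume "\<not> 0 < k"
      then have "m + (- k) * e \<in> S"
        using m by (intro add_multiple_multiplicity) (auto simp: max_ideal_def)
      moreover have "0 \<le> (- k) * e"
        using \<open>\<not> 0 < k\<close> multiplicity_pos by (intro mult_nonneg_nonneg) auto
      then have "m + (- k) * e \<noteq> 0"
        using multiplicity_le[OF m] multiplicity_pos by linarith
      moreover have "g = x + (m + (- k) * e)"
        using k by simp
      moreover have "x \<in> S" "x \<noteq> 0"
        using xM by (simp_all add: max_ideal_def)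
      ultimately show False
        using minimal_generator_irreducible[OF numerical g(1)] by blast
    qed
    then have "g + (k - 1) * e \<in> S"
      using minimal_generator_in_max_ideal[OF numerical g(1)]
      by (intro add_multiple_multiplicity) (auto simp: max_ideal_def)
    then show ?thesis
      using k by (simp add: algebra_simps)
  qed
  ultimately show ?thesis
    by (auto simp: pseudo_frobenius_def set_colon_def)
qed

section \<open>Pseudo-Frobenius numbers acting on the canonical ideal\<close>

lemma pseudo_frobenius_add:
  "\<alpha> \<in> pseudo_frobenius S \<Longrightarrow> s \<in> S \<Longrightarrow> s \<noteq> 0 \<Longrightarrow> \<alpha> + s \<in> S"
  by (auto simp: pseudo_frobenius_def set_colon_def max_ideal_def)

lemma canonical_ideal_add_pseudo_frobenius:
  assumes "k \<in> K" and "\<alpha> \<in> pseudo_frobenius S" and "0 \<le> \<alpha>" and "k + \<alpha> \<noteq> F"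
  shows "k + \<alpha> \<in> K"
proof (rule ccontr)
  assume "k + \<alpha> \<notin> K"
  then have "F - (k + \<alpha>) \<in> S"
    using assms by (auto simp: canonical_ideal_iff)
  then have "\<alpha> + (F - (k + \<alpha>)) \<in> S"
    using assms by (intro pseudo_frobenius_add) auto
  then show False
    using assms by (simp add: canonical_ideal_iff)
qed

text \<open>
  Write \<open>F - x = k + l\<close> with \<open>k, l \<in> K\<close> and \<open>\<alpha> = x - e\<close>. Then \<open>F - e\<close> is both \<open>k + (l + \<alpha>)\<close> and
  \<open>(k + \<alpha>) + l\<close>, so it lies in \<open>2K\<close> unless \<open>k\<close> and \<open>l\<close> both equal the exceptional element \<open>F - \<alpha>\<close>. In
  that case \<open>F - e = 2F - \<alpha>\<close>, so \<open>\<alpha> = F + e\<close> is in \<open>S\<close>, which is impossible.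
\<close>

lemma minus_multiplicity_in_double:
  assumes xM: "x \<in> M" and pf: "x - e \<in> pseudo_frobenius S" and "F - x \<in> K + K"
  shows "F - e \<in> K + K"
proof (rule ccontr)
  assume no: "F - e \<notin> K + K"
  obtain k l where kl: "k \<in> K" "l \<in> K" "F - x = k + l"
    using assms(3) by (rule set_plus_elim)
  have le: "0 \<le> x - e"
    using multiplicity_le[OF xM] by simp
  have "k + (l + (x - e)) \<notin> K + K" "(k + (x - e)) + l \<notin> K + K"
    using no kl(3) by (simp_all add: algebra_simps)
  then have "l + (x - e) \<notin> K" "k + (x - e) \<notin> K"
    using kl by (blast intro: set_plus_intro)+
  then have "l + (x - e) = F" "k + (x - e) = F"
    using canonical_ideal_add_pseudo_frobenius[OF _ pf le] kl by blast+
  then have "F < x - e"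
    using kl multiplicity_pos by linarith
  then show False
    using frobenius_less pf by (auto simp: pseudo_frobenius_def)
qed

section \<open>The 2-AGL property\<close>

text \<open>
  The sums that could leave \<open>2K\<close> are \<open>F + k\<close> and \<open>F - e + k\<close> with \<open>0 \<noteq> k \<in> K\<close>. The first exceeds \<open>F\<close> and
  so lies in \<open>K\<close>. The second lies in \<open>K\<close> unless \<open>e - k \<in> S\<close>, which forces \<open>k = e\<close> by minimality of \<open>e\<close>,
  and then it equals \<open>F\<close>.
\<close>

lemma two_AGL_if_double:
  assumes dbl: "(K + K) - K = {F - e, F}"
  shows "two_AGL S"
proof -
  have add_closed: "y + k \<in> K + K" if y: "y \<in> K + K" and k: "k \<in> K" for y k
  proof (cases "y \<in> K \<or> k = 0")
    case True
    then show ?thesis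
      using y k set_plus_intro[of y K k K] by auto
  next
    case False
    then have "0 < k"
      using k by (simp add: canonical_ideal_iff)
    have y': "y = F - e \<or> y = F"
      using y False dbl by blast
    have pos: "0 \<le> y + k"
      using double_canonical_ideal_nonneg[OF y] \<open>0 < k\<close> by simp
    show ?thesis
    proof (rule ccontr)
      assume "y + k \<notin> K + K"
      then have notK: "y + k \<notin> K" and notF: "y + k \<noteq> F"
        using canonical_ideal_subset_double dbl by auto
      then have "F - (y + k) \<in> M"
        using pos by (auto simp: canonical_ideal_iff max_ideal_def)
      then have "e \<le> F - (y + k)"
        by (rule multiplicity_le)
      then show False
        using y' \<open>0 < k\<close> multiplicity_pos by auto
    qed
  qed
  have "add_submonoid (K + K)"
  proof (rule add_submonoidI)
    show "0 \<in> K + K"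
      using canonical_ideal_subset_double zero_in_canonical_ideal by auto
    fix y z assume y: "y \<in> K + K" and "z \<in> K + K"
    then obtain k l where "k \<in> K" "l \<in> K" "z = k + l"
      by (blast elim: set_plus_elim)
    then show "y + z \<in> K + K"
      using add_closed[OF add_closed[OF y]] by (simp add: add.assoc)
  qed
  then have "generated K \<subseteq> K + K"
    by (intro hull_minimal canonical_ideal_subset_double)
  moreover have "K + K \<subseteq> generated K"
    using hull_subset[of K add_submonoid] by (blast elim: set_plus_elim intro: generated_add)
  ultimately have "generated K - K = {F - e, F}"
    using dbl by auto
  then show ?thesis
    using multiplicity_pos by (simp add: two_AGL_def)
qed

section \<open>GAS semigroups of maximal embedding dimension\<close>

lemma double_canonical_ideal_if_GAS:
  assumes med: "max_embedding_dim S" and gas: "GAS S"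
    and not_small: "\<not> (K + K) - K \<subseteq> {F}"
  shows "(K + K) - K = {F - e, F}"
proof -
  obtain r :: nat and x :: "nat \<Rightarrow> int" where
      gens: "\<forall>i\<in>{1..r}. x i \<in> minimal_generators S"
    and diffs: "\<forall>i\<in>{1..r}. \<forall>j\<in>{1..r}. x i - x j \<notin> pseudo_frobenius S"
    and dbl: "(K + K) - K = {F - x i | i. i \<in> {1..r}} \<union> {F}"
    using gas not_small unfolding GAS_def Let_def by auto
  obtain i where i: "i \<in> {1..r}"
    using dbl not_small by auto
  have Fx: "F - x i \<in> K + K"
    using dbl i by blast
  have "F - e \<in> K + K"
  proof (cases "x i = e")
    case False
    show ?thesis
    proof (rule minus_multiplicity_in_double[OF _ _ Fx])
      show "x i \<in> M"
        using minimal_generator_in_max_ideal[OF numerical] gens i by blast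
      show "x i - e \<in> pseudo_frobenius S"
        using minimal_generator_minus_multiplicity[OF med] gens i False by blast
    qed
  qed (use Fx in simp)
  moreover have "F - e \<notin> K"
    using multiplicity_mem by (simp add: canonical_ideal_iff)
  ultimately have "F - e \<in> {F - x i | i. i \<in> {1..r}} \<union> {F}"
    using dbl by blast
  then obtain j where j: "j \<in> {1..r}" "x j = e"
    using multiplicity_pos by auto
  have "x k = e" if "k \<in> {1..r}" for k
    using minimal_generator_minus_multiplicity[OF med, of "x k"] gens diffs j that by metis
  then have "{F - x i | i. i \<in> {1..r}} = {F - e}"
    using j by force
  then show ?thesis
    using dbl by (simp add: insert_commute)
qed

end

theorem proposition3p4:
  fixes S :: "int set" and e :: int
  assumes "numerical_semigroup S"
    and "S \<noteq> {0..}"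
    and "e = semigroup_multiplicity S"
    and "max_embedding_dim S"
    and "GAS S"
  shows "almost_symmetric S \<or>
    (two_AGL S \<and>
      (canonical_ideal S + canonical_ideal S) - canonical_ideal S = {frobenius S - e, frobenius S})"
proof -
  interpret proper_numerical_semigroup S
    by unfold_locales (rule assms)+
  show ?thesis
    using almost_symmetric_if_no_positive_difference double_canonical_ideal_if_GAS[OF assms(4,5)]
      two_AGL_if_double assms(3) by blast
qed

end
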